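(* Let $a>0$, let $\alpha(t)=(\cos t,\sin t,0)$, $t\in\mathbb{R}$ (a spacelike circle of $\mathbb{L}^3$ with timelike axis), and let $$V(t)=\sinh(at)\,\mathbf{n}(t)+\cosh(at)\,\mathbf{b}(t)=(-\sinh(at)\cos t,\,-\sinh(at)\sin t,\,\cosh(at)),$$ where $\mathbf{n}(t)=(-\cos t,-\sin t,0)$ and $\mathbf{b}(t)=(0,0,1)$. Then the Björling surface with data $\alpha$ and $V$ is parametrized by $X(u,v)=(X_1(u,v),X_2(u,v),X_3(u,v))$, where $$X_1=\cos u\cosh v+\frac{1}{a^2+1}\Big(a\cos u\sin(av)\cosh(au)\cosh v-a\sin u\cos(av)\sinh(au)\sinh v+\cos u\cos(av)\cosh(au)\sinh v+\sin u\sin(av)\sinh(au)\cosh v\Big),$$ $$X_2=\sin u\cosh v+\frac{1}{a^2+1}\Big(a\cos u\cos(av)\sinh(au)\sinh v+a\sin u\sin(av)\cosh(au)\cosh v+\sin u\cos(av)\cosh(au)\sinh v-\cos u\sin(av)\sinh(au)\cosh v\Big),$$ $$X_3=-\frac{\sin(av)\sinh(au)}{a}.$$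
   Context: $\mathbb{L}^3$ is $\mathbb{R}^3$ with the metric $\langle,\rangle=dx^2+dy^2-dz^2$. The Lorentzian cross product is $(x_1,x_2,x_3)\times(y_1,y_2,y_3)=(x_2y_3-x_3y_2,\ x_3y_1-x_1y_3,\ -(x_1y_2-x_2y_1))$, extended complex-bilinearly. A maximal surface is a spacelike surface (induced metric Riemannian) with zero mean curvature everywhere. Björling problem: given a real analytic spacelike curve $\alpha:I\to\mathbb{L}^3$ and a real analytic unit timelike vector field $V$ along $\alpha$ with $\langle V,\alpha'\rangle=0$, find a maximal surface containing $\alpha$ with unit normal $V$ along $\alpha$. Its solution (the Björling surface with data $\alpha,V$, unique with $\alpha$ being the parameter curve $v=0$) is $$X(u,v)=\mathrm{Re}\left(\alpha(z)+i\int_{u_0}^z V(w)\times\alpha'(w)\,dw\right),\qquad z=u+iv,$$ where $u_0\in I$ is fixed and $\alpha(z),V(z)$ are the holomorphic extensions of $\alpha,V$ to a simply-connected domain of $\mathbb{C}$ containing $I\times\{0\}$. Maximality is understood away from points where $X$ fails to be an immersion with nondegenerate induced metric. *)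

theory Defs
  imports "HOL-Complex_Analysis.Complex_Analysis"
begin

section \<open>Lorentz--Minkowski space\<close>

text \<open>The same formulas serve \<open>real ^ 3\<close> and, by bilinear extension, \<open>complex ^ 3\<close>.\<close>

definition lorentz :: "'a::comm_ring_1 ^ 3 \<Rightarrow> 'a ^ 3 \<Rightarrow> 'a" where
  "lorentz x y = x $ 1 * y $ 1 + x $ 2 * y $ 2 - x $ 3 * y $ 3"

definition lcross :: "'a::comm_ring_1 ^ 3 \<Rightarrow> 'a ^ 3 \<Rightarrow> 'a ^ 3" where
  "lcross x y = vector [x $ 2 * y $ 3 - x $ 3 * y $ 2,
                        x $ 3 * y $ 1 - x $ 1 * y $ 3,
                        - (x $ 1 * y $ 2 - x $ 2 * y $ 1)]"

section \<open>Maximal surfaces\<close>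

text \<open>A parametrized surface is a map \<open>X u v\<close>; its parameter domain is a set \<open>D\<close> of complex
  numbers, where \<open>(u, v)\<close> is identified with \<open>Complex u v\<close>.\<close>

definition Du :: "(real \<Rightarrow> real \<Rightarrow> real ^ 3) \<Rightarrow> real \<Rightarrow> real \<Rightarrow> real ^ 3" where
  "Du X u v = vector_derivative (\<lambda>s. X s v) (at u)"

definition Dv :: "(real \<Rightarrow> real \<Rightarrow> real ^ 3) \<Rightarrow> real \<Rightarrow> real \<Rightarrow> real ^ 3" where
  "Dv X u v = vector_derivative (\<lambda>s. X u s) (at v)"

primrec C_k_on :: "nat \<Rightarrow> complex set \<Rightarrow> (real \<Rightarrow> real \<Rightarrow> real ^ 3) \<Rightarrow> bool" where
  "C_k_on 0 D X \<longleftrightarrow> continuous_on D (\<lambda>z. X (Re z) (Im z))"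
| "C_k_on (Suc k) D X \<longleftrightarrow>
     continuous_on D (\<lambda>z. X (Re z) (Im z)) \<and>
     (\<forall>z\<in>D. (\<lambda>s. X s (Im z)) differentiable at (Re z) \<and>
             (\<lambda>s. X (Re z) s) differentiable at (Im z)) \<and>
     C_k_on k D (Du X) \<and> C_k_on k D (Dv X)"

definition smooth_surface_on :: "complex set \<Rightarrow> (real \<Rightarrow> real \<Rightarrow> real ^ 3) \<Rightarrow> bool" where
  "smooth_surface_on D X \<longleftrightarrow> (\<forall>k. C_k_on k D X)"

definition fff_E :: "(real \<Rightarrow> real \<Rightarrow> real ^ 3) \<Rightarrow> real \<Rightarrow> real \<Rightarrow> real" where
  "fff_E X u v = lorentz (Du X u v) (Du X u v)"

definition fff_F :: "(real \<Rightarrow> real \<Rightarrow> real ^ 3) \<Rightarrow> real \<Rightarrow> real \<Rightarrow> real" where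
  "fff_F X u v = lorentz (Du X u v) (Dv X u v)"

definition fff_G :: "(real \<Rightarrow> real \<Rightarrow> real ^ 3) \<Rightarrow> real \<Rightarrow> real \<Rightarrow> real" where
  "fff_G X u v = lorentz (Dv X u v) (Dv X u v)"

definition fff_det :: "(real \<Rightarrow> real \<Rightarrow> real ^ 3) \<Rightarrow> real \<Rightarrow> real \<Rightarrow> real" where
  "fff_det X u v = fff_E X u v * fff_G X u v - (fff_F X u v)\<^sup>2"

text \<open>The Gram determinant vanishes when \<open>Du X\<close> and \<open>Dv X\<close> are linearly dependent, so
  \<open>regular_at\<close> says that \<open>X\<close> is an immersion whose induced metric is nondegenerate.\<close>

definition regular_at :: "(real \<Rightarrow> real \<Rightarrow> real ^ 3) \<Rightarrow> real \<Rightarrow> real \<Rightarrow> bool" where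
  "regular_at X u v \<longleftrightarrow> fff_det X u v \<noteq> 0"

definition spacelike_at :: "(real \<Rightarrow> real \<Rightarrow> real ^ 3) \<Rightarrow> real \<Rightarrow> real \<Rightarrow> bool" where
  "spacelike_at X u v \<longleftrightarrow> 0 < fff_E X u v \<and> 0 < fff_det X u v"

definition unit_normal :: "(real \<Rightarrow> real \<Rightarrow> real ^ 3) \<Rightarrow> real \<Rightarrow> real \<Rightarrow> real ^ 3" where
  "unit_normal X u v =
     (let n = lcross (Du X u v) (Dv X u v) in n /\<^sub>R sqrt \<bar>lorentz n n\<bar>)"

text \<open>The overall sign of the mean curvature depends on convention; only its vanishing is used.\<close>

definition mean_curvature :: "(real \<Rightarrow> real \<Rightarrow> real ^ 3) \<Rightarrow> real \<Rightarrow> real \<Rightarrow> real" where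
  "mean_curvature X u v =
     (let N = unit_normal X u v;
          e = lorentz N (Du (Du X) u v);
          f = lorentz N (Dv (Du X) u v);
          g = lorentz N (Dv (Dv X) u v)
      in (e * fff_G X u v - 2 * f * fff_F X u v + g * fff_E X u v) / (2 * fff_det X u v))"

definition maximal_surface_on :: "complex set \<Rightarrow> (real \<Rightarrow> real \<Rightarrow> real ^ 3) \<Rightarrow> bool" where
  "maximal_surface_on D X \<longleftrightarrow>
     smooth_surface_on D X \<and>
     (\<forall>u v. Complex u v \<in> D \<and> regular_at X u v \<longrightarrow>
        spacelike_at X u v \<and> mean_curvature X u v = 0)"

section \<open>The Bjorling problem\<close>

definition real_analytic_curve_on :: "real set \<Rightarrow> (real \<Rightarrow> real ^ 3) \<Rightarrow> bool" where
  "real_analytic_curve_on I f \<longleftrightarrow>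
     (\<forall>t0\<in>I. \<forall>j. \<exists>c :: nat \<Rightarrow> real. \<exists>r>0. \<forall>t\<in>I. \<bar>t - t0\<bar> < r \<longrightarrow>
        (\<lambda>n. c n * (t - t0) ^ n) sums (f t $ j))"

definition bjorling_data :: "real set \<Rightarrow> (real \<Rightarrow> real ^ 3) \<Rightarrow> (real \<Rightarrow> real ^ 3) \<Rightarrow> bool" where
  "bjorling_data I \<alpha> V \<longleftrightarrow>
     open I \<and> is_interval I \<and> I \<noteq> {} \<and>
     real_analytic_curve_on I \<alpha> \<and> real_analytic_curve_on I V \<and>
     (\<forall>t\<in>I. 0 < lorentz (vector_derivative \<alpha> (at t)) (vector_derivative \<alpha> (at t)) \<and>
             lorentz (V t) (V t) = - 1 \<and>
             lorentz (V t) (vector_derivative \<alpha> (at t)) = 0)"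

definition solves_bjorling_problem ::
  "real set \<Rightarrow> complex set \<Rightarrow> (real \<Rightarrow> real ^ 3) \<Rightarrow> (real \<Rightarrow> real ^ 3)
     \<Rightarrow> (real \<Rightarrow> real \<Rightarrow> real ^ 3) \<Rightarrow> bool" where
  "solves_bjorling_problem I D \<alpha> V X \<longleftrightarrow>
     maximal_surface_on D X \<and>
     (\<forall>t\<in>I. X t 0 = \<alpha> t \<and> regular_at X t 0 \<and> unit_normal X t 0 = V t)"

definition holomorphic_extension ::
  "real set \<Rightarrow> complex set \<Rightarrow> (real \<Rightarrow> real ^ 3) \<Rightarrow> (complex \<Rightarrow> complex ^ 3) \<Rightarrow> bool" where
  "holomorphic_extension I D f F \<longleftrightarrow>
     (\<forall>j. (\<lambda>z. F z $ j) holomorphic_on D \<and>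
          (\<forall>t\<in>I. F (complex_of_real t) $ j = complex_of_real (f t $ j)))"

definition cderiv :: "(complex \<Rightarrow> complex ^ 3) \<Rightarrow> complex \<Rightarrow> complex ^ 3" where
  "cderiv F z = (\<chi> j. deriv (\<lambda>w. F w $ j) z)"

text \<open>The Schwarz-type formula. The integral from \<open>u0\<close> to \<open>z\<close> may be taken along any path in
  the simply connected domain \<open>D\<close>; such a path exists because \<open>D\<close> is open and connected.\<close>

definition is_bjorling_surface ::
  "real set \<Rightarrow> complex set \<Rightarrow> real \<Rightarrow> (real \<Rightarrow> real ^ 3) \<Rightarrow> (real \<Rightarrow> real ^ 3)
     \<Rightarrow> (real \<Rightarrow> real \<Rightarrow> real ^ 3) \<Rightarrow> bool" where
  "is_bjorling_surface I D u0 \<alpha> V X \<longleftrightarrow>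
     bjorling_data I \<alpha> V \<and> u0 \<in> I \<and>
     open D \<and> simply_connected D \<and> complex_of_real ` I \<subseteq> D \<and>
     (\<exists>A W. holomorphic_extension I D \<alpha> A \<and> holomorphic_extension I D V W \<and>
        (\<forall>z\<in>D. \<forall>\<gamma>. valid_path \<gamma> \<and> path_image \<gamma> \<subseteq> D \<and>
             pathstart \<gamma> = complex_of_real u0 \<and> pathfinish \<gamma> = z \<longrightarrow>
           X (Re z) (Im z) =
             (\<chi> j. Re (A z $ j +
                \<i> * contour_integral \<gamma> (\<lambda>w. lcross (W w) (cderiv A w) $ j)))))"

section \<open>The circle and its normal fields\<close>

definition circ :: "real \<Rightarrow> real ^ 3" where
  "circ t = vector [cos t, sin t, 0]"

definition circ_n :: "real \<Rightarrow> real ^ 3" where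
  "circ_n t = vector [- cos t, - sin t, 0]"

definition circ_b :: "real \<Rightarrow> real ^ 3" where
  "circ_b t = vector [0, 0, 1]"

definition circ_V :: "real \<Rightarrow> real \<Rightarrow> real ^ 3" where
  "circ_V a t = sinh (a * t) *\<^sub>R circ_n t + cosh (a * t) *\<^sub>R circ_b t"

lemma circ_V_eq:
  "circ_V a t = vector [- sinh (a * t) * cos t, - sinh (a * t) * sin t, cosh (a * t)]"
  by (simp add: circ_V_def circ_n_def circ_b_def vec_eq_iff forall_3)

end

theory Submission imports Defs begin

no_notation fps_nth (infixl \<open>$\<close> 75)

text \<open>The holomorphic extensions of \<open>\<alpha>\<close> and \<open>V\<close> are unique by analytic continuation, and
  \<open>V \<times> \<alpha>'\<close> has an explicit entire primitive whose value at \<open>u\<^sub>0\<close> is real, hence contributes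
  nothing to \<open>X\<close>. So the Bjorling surface is the real part of an explicit entire curve \<open>\<Phi>\<close>.
  It is maximal because \<open>\<langle>\<Phi>', \<Phi>'\<rangle> = 0\<close>: the parameters are then conformal, and the coordinates
  are harmonic.\<close>

section \<open>Real parts of entire curves\<close>

definition entire_curve :: "(complex \<Rightarrow> complex ^ 3) \<Rightarrow> bool" where
  "entire_curve F \<longleftrightarrow> (\<forall>j. (\<lambda>z. F z $ j) holomorphic_on UNIV)"

definition re_surface :: "(complex \<Rightarrow> complex ^ 3) \<Rightarrow> real \<Rightarrow> real \<Rightarrow> real ^ 3" where
  "re_surface F u v = (\<chi> j. Re (F (Complex u v) $ j))"

lemma has_vector_derivative_componentwise:
  fixes f :: "real \<Rightarrow> real ^ 'n"
  assumes "\<And>j. ((\<lambda>t. f t $ j) has_real_derivative D $ j) (at t)"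
  shows "(f has_vector_derivative D) (at t)"
  unfolding has_vector_derivative_def
proof (subst has_derivative_componentwise_within, safe)
  fix i :: "real ^ 'n" assume "i \<in> Basis"
  then obtain j where "i = axis j 1"
    by (auto simp: Basis_vec_def)
  then show "((\<lambda>x. f x \<bullet> i) has_derivative (\<lambda>x. (x *\<^sub>R D) \<bullet> i)) (at t)"
    using assms[of j] by (simp add: inner_axis has_field_derivative_def mult_commute_abs)
qed

lemma cderiv_eqI:
  assumes "\<And>j. ((\<lambda>w. F w $ j) has_field_derivative D $ j) (at z)"
  shows "cderiv F z = D"
  using assms by (simp add: cderiv_def vec_eq_iff DERIV_imp_deriv)

lemma entire_curve_has_field_derivative:
  assumes "entire_curve F"
  shows "((\<lambda>w. F w $ j) has_field_derivative cderiv F z $ j) (at z)"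
  using assms by (auto simp: entire_curve_def cderiv_def intro: holomorphic_derivI)

lemma entire_curve_cderiv: "entire_curve F \<Longrightarrow> entire_curve (cderiv F)"
  by (auto simp: entire_curve_def cderiv_def intro: holomorphic_deriv)

lemma entire_curve_cmult: "entire_curve F \<Longrightarrow> entire_curve (\<lambda>z. c *s F z)"
  by (auto simp: entire_curve_def intro!: holomorphic_intros)

lemma cderiv_cmult: "entire_curve F \<Longrightarrow> cderiv (\<lambda>z. c *s F z) z = c *s cderiv F z"
  by (rule cderiv_eqI) (auto intro!: derivative_eq_intros entire_curve_has_field_derivative)

text \<open>Chain rule along horizontal and vertical lines, whose velocities are 1 and
  \<open>\<i>\<close>. Both partial derivatives are thus again real parts of entire curves, which
  gives all higher derivatives by iteration.\<close>

lemma re_surface_has_vector_derivative: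
  assumes "entire_curve F"
  shows "((\<lambda>s. re_surface F s v) has_vector_derivative re_surface (cderiv F) u v) (at u)"
    and "((\<lambda>s. re_surface F u s) has_vector_derivative
            re_surface (\<lambda>z. \<i> *s cderiv F z) u v) (at v)"
proof -
  have u: "((\<lambda>s. Complex s v) has_vector_derivative 1) (at u)"
    and v: "((\<lambda>s. Complex u s) has_vector_derivative \<i>) (at v)"
    by (auto simp: has_vector_derivative_complex_iff intro!: derivative_eq_intros)
  note chain = field_vector_diff_chain_at[OF _ entire_curve_has_field_derivative[OF assms], unfolded o_def]
  show "((\<lambda>s. re_surface F s v) has_vector_derivative re_surface (cderiv F) u v) (at u)"
    using has_field_derivative_Re[OF chain[OF u]]
    by (intro has_vector_derivative_componentwise) (simp add: re_surface_def)
  show "((\<lambda>s. re_surface F u s) has_vector_derivative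
            re_surface (\<lambda>z. \<i> *s cderiv F z) u v) (at v)"
    using has_field_derivative_Re[OF chain[OF v]]
    by (intro has_vector_derivative_componentwise) (simp add: re_surface_def)
qed

lemma Du_re_surface: "entire_curve F \<Longrightarrow> Du (re_surface F) = re_surface (cderiv F)"
  by (intro ext)
    (simp add: Du_def vector_derivative_at[OF re_surface_has_vector_derivative(1)])

lemma Dv_re_surface: "entire_curve F \<Longrightarrow> Dv (re_surface F) = re_surface (\<lambda>z. \<i> *s cderiv F z)"
  by (intro ext)
    (simp add: Dv_def vector_derivative_at[OF re_surface_has_vector_derivative(2)])

lemma continuous_on_re_surface:
  assumes "entire_curve F"
  shows "continuous_on D (\<lambda>z. re_surface F (Re z) (Im z))"
proof -
  have "continuous_on D (\<lambda>z. F z $ j)" for j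
    using assms holomorphic_on_imp_continuous_on continuous_on_subset
    unfolding entire_curve_def by blast
  then show ?thesis
    unfolding re_surface_def complex.collapse
    by (intro continuous_on_vec_lambda continuous_on_Re)
qed

text \<open>Real parts of entire curves are closed under \<open>Du\<close> and \<open>Dv\<close>;
  the induction therefore runs over all \<open>F\<close> at once.\<close>

lemma C_k_on_re_surface: "entire_curve F \<Longrightarrow> C_k_on k D (re_surface F)"
proof (induction k arbitrary: F)
  case 0
  then show ?case by (simp add: continuous_on_re_surface)
next
  case (Suc k)
  then show ?case
    using re_surface_has_vector_derivative[OF Suc.prems, THEN differentiableI_vector]
    by (simp add: continuous_on_re_surface Du_re_surface Dv_re_surface entire_curve_cderiv
        entire_curve_cmult)
qed

section \<open>Isotropic curves and maximal surfaces\<close>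

text \<open>Orthogonality would equate \<open>x $ 3 * y $ 3\<close> with the inner product of the
  planar parts. Timelikeness makes its square exceed the product of the planar squared norms,
  against Cauchy-Schwarz in the plane.\<close>

lemma lorentz_timelike_not_orthogonal:
  fixes x y :: "real ^ 3"
  assumes "lorentz x x < 0" "lorentz y y < 0"
  shows "lorentz x y \<noteq> 0"
proof
  assume "lorentz x y = 0"
  then have eq: "x $ 3 * y $ 3 = x $ 1 * y $ 1 + x $ 2 * y $ 2"
    by (simp add: lorentz_def)
  have "((x $ 1)\<^sup>2 + (x $ 2)\<^sup>2) * ((y $ 1)\<^sup>2 + (y $ 2)\<^sup>2) < (x $ 3)\<^sup>2 * (y $ 3)\<^sup>2"
    using assms by (intro mult_strict_mono')
      (auto simp: lorentz_def power2_eq_square)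
  also have "\<dots> = (x $ 1 * y $ 1 + x $ 2 * y $ 2)\<^sup>2"
    by (simp flip: eq add: power_mult_distrib)
  \<comment> \<open>Lagrange's identity in the plane.\<close>
  also have "\<dots> = ((x $ 1)\<^sup>2 + (x $ 2)\<^sup>2) * ((y $ 1)\<^sup>2 + (y $ 2)\<^sup>2) - (x $ 1 * y $ 2 - x $ 2 * y $ 1)\<^sup>2"
    by algebra
  finally show False
    by simp
qed

text \<open>Isotropy makes the parameters conformal, so the mean curvature reduces to
  \<open>\<langle>N, \<Delta>X\<rangle>\<close> up to a factor, which vanishes since \<open>X\<close> is harmonic.\<close>

lemma maximal_surface_on_re_surface:
  assumes F: "entire_curve F" and iso: "\<And>z. lorentz (cderiv F z) (cderiv F z) = 0"
  shows "maximal_surface_on D (re_surface F)"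
  unfolding maximal_surface_on_def
proof (intro conjI allI impI; (elim conjE)?)
  let ?X = "re_surface F"
  note F' = entire_curve_cderiv[OF F]
  note iF' = entire_curve_cmult[OF F', of \<i>]
  show "smooth_surface_on D ?X"
    by (simp add: smooth_surface_on_def C_k_on_re_surface F)
  fix u v assume reg: "regular_at ?X u v"
  define p where "p = cderiv F (Complex u v)"
  \<comment> \<open>So p = X_u - i X_v and <p,p> = E - G - 2iF; its real and imaginary parts give
    the two conformality relations below.\<close>
  have Du: "Du ?X u v = (\<chi> j. Re (p $ j))" and Dv: "Dv ?X u v = (\<chi> j. - Im (p $ j))"
    by (simp_all add: Du_re_surface Dv_re_surface F re_surface_def p_def)
  have p: "lorentz p p = 0"
    using iso by (simp add: p_def)
  have EG: "fff_G ?X u v = fff_E ?X u v"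
    using arg_cong[OF p, of Re] by (simp add: fff_E_def fff_G_def Du Dv lorentz_def)
  have F0: "fff_F ?X u v = 0"
    using arg_cong[OF p, of Im] by (simp add: fff_F_def Du Dv lorentz_def mult.commute)
  \<comment> \<open>If E = G were negative, X_u and X_v would be two orthogonal timelike vectors.
    Regularity then excludes E = 0, because the determinant is the square of E.\<close>
  have "\<not> fff_E ?X u v < 0"
    using lorentz_timelike_not_orthogonal[of "Du ?X u v" "Dv ?X u v"] EG F0
    by (auto simp: fff_E_def fff_G_def fff_F_def)
  moreover have "fff_E ?X u v \<noteq> 0"
    using reg by (auto simp: regular_at_def fff_det_def EG F0)
  ultimately show "spacelike_at ?X u v"
    by (simp add: spacelike_at_def fff_det_def EG F0)
  \<comment> \<open>Harmonicity: differentiating twice in v multiplies the second complex derivative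
    by the square of \<open>\<i>\<close>. Hence e and g cancel in the mean curvature.\<close>
  have "Dv (Dv ?X) u v = - Du (Du ?X) u v"
    by (simp add: Du_re_surface Dv_re_surface F F' iF' cderiv_cmult re_surface_def vec_eq_iff)
  then have "lorentz N (Dv (Dv ?X) u v) = - lorentz N (Du (Du ?X) u v)" for N
    by (simp add: lorentz_def)
  then show "mean_curvature ?X u v = 0"
    by (simp add: mean_curvature_def Let_def EG F0)
qed

section \<open>The Schwarz-type formula\<close>

text \<open>The Taylor series of the extension at a real point may a priori have complex
  coefficients. At real \<open>t\<close> the powers of \<open>t - t0\<close> are real, so taking
  real parts leaves a real power series for \<open>f\<close>.\<close>

lemma real_analytic_curve_on_holomorphic_extension:
  assumes "open D" "of_real ` I \<subseteq> D" and F: "holomorphic_extension I D f F"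
  shows "real_analytic_curve_on I f"
  unfolding real_analytic_curve_on_def
proof (intro ballI allI)
  fix t0 j assume t0: "t0 \<in> I"
  let ?g = "\<lambda>z. F z $ j"
  let ?c = "\<lambda>n. (deriv ^^ n) ?g (of_real t0) / fact n"
  obtain r where r: "r > 0" "ball (complex_of_real t0) r \<subseteq> D"
    using assms t0 by (meson image_eqI open_contains_ball subsetD)
  have hol: "?g holomorphic_on ball (of_real t0) r"
    using F r holomorphic_on_subset unfolding holomorphic_extension_def by blast
  have "(\<lambda>n. Re (?c n) * (t - t0) ^ n) sums (f t $ j)" if "t \<in> I" "\<bar>t - t0\<bar> < r" for t
  proof -
    have "of_real t \<in> ball (complex_of_real t0) r"
      using that by (simp add: dist_real_def abs_minus_commute)
    then have "(\<lambda>n. Re (?c n * (of_real t - of_real t0) ^ n)) sums Re (?g (of_real t))"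
      by (intro sums_Re holomorphic_power_series[OF hol])
    moreover have "Re (c * (of_real t - of_real t0) ^ n) = Re c * (t - t0) ^ n" for c n
      by (simp flip: of_real_diff of_real_power)
    ultimately show ?thesis
      using F that by (simp only: holomorphic_extension_def) simp
  qed
  then show "\<exists>c r. r > 0 \<and> (\<forall>t\<in>I. \<bar>t - t0\<bar> < r \<longrightarrow> (\<lambda>n. c n * (t - t0) ^ n) sums (f t $ j))"
    using r(1) by (intro exI[of _ "\<lambda>n. Re (?c n)"] exI[of _ r]) simp
qed

text \<open>Identity theorem: the difference vanishes on the image of \<open>I\<close>, which
  accumulates at one of its own points inside the connected set \<open>D\<close>.\<close>

lemma holomorphic_extension_unique:
  assumes I: "open I" "I \<noteq> {}" and D: "open D" "connected D" "of_real ` I \<subseteq> D"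
    and F: "holomorphic_extension I D f F" and G: "holomorphic_extension I D f G" and z: "z \<in> D"
  shows "F z = G z"
proof (rule vec_eq_iff[THEN iffD2], rule allI)
  fix j
  obtain t0 where t0: "t0 \<in> I"
    using I by blast
  have "t0 islimpt I"
    using I t0 by (simp add: interior_limit_point interior_open)
  \<comment> \<open>Removing \<open>t0\<close> keeps the image point outside the set, as required
    for carrying a limit point along a continuous map.\<close>
  then have "t0 islimpt of_real -` complex_of_real ` (I - {t0}) \<inter> UNIV"
    by (auto simp: inj_vimage_image_eq inj_def islimpt_def)
  then have "complex_of_real t0 islimpt of_real ` (I - {t0})"
    by (rule islimpt_image) (auto intro: continuous_intros)
  then have "complex_of_real t0 islimpt of_real ` I"
    by (rule islimpt_subset) auto
  then have "F z $ j - G z $ j = 0"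
  proof (rule analytic_continuation[where f = "\<lambda>z. F z $ j - G z $ j", rotated 5])
    show "(\<lambda>z. F z $ j - G z $ j) holomorphic_on D"
      using F G by (auto simp: holomorphic_extension_def intro: holomorphic_on_diff)
    show "F w $ j - G w $ j = 0" if "w \<in> of_real ` I" for w
      using F G that by (auto simp: holomorphic_extension_def)
  qed (use D t0 z in auto)
  then show "F z $ j = G z $ j"
    by simp
qed

lemma cderiv_cong:
  assumes "open D" "z \<in> D" "\<And>w. w \<in> D \<Longrightarrow> F w = G w"
  shows "cderiv F z = cderiv G z"
proof -
  have "eventually (\<lambda>w. F w = G w) (nhds z)"
    using assms eventually_nhds by blast
  then have "eventually (\<lambda>w. F w $ j = G w $ j) (nhds z)" for j
    by eventually_elim simp
  then show ?thesis
    by (simp add: cderiv_def vec_eq_iff deriv_cong_ev)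
qed

text \<open>Eliminates the choice of extensions and of paths: the former are unique on
  \<open>D\<close>, and a primitive \<open>P\<close> makes the integral depend on the endpoints
  only.\<close>

lemma is_bjorling_surface_iff:
  assumes data: "bjorling_data I \<alpha> V" and u0: "u0 \<in> I"
    and D: "open D" "simply_connected D" "of_real ` I \<subseteq> D"
    and A: "holomorphic_extension I D \<alpha> A" and W: "holomorphic_extension I D V W"
    and P: "\<And>z j. z \<in> D \<Longrightarrow>
      ((\<lambda>w. P w $ j) has_field_derivative lcross (W z) (cderiv A z) $ j) (at z)"
  shows "is_bjorling_surface I D u0 \<alpha> V Y \<longleftrightarrow>
    (\<forall>u v. Complex u v \<in> D \<longrightarrow> Y u v =
       (\<chi> j. Re (A (Complex u v) $ j + \<i> * (P (Complex u v) $ j - P (of_real u0) $ j))))"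
    (is "_ \<longleftrightarrow> ?R")
proof
  have I: "open I" "I \<noteq> {}"
    using data by (auto simp: bjorling_data_def)
  have conn: "connected D"
    using D simply_connected_imp_connected by blast
  have ci: "contour_integral \<gamma> (\<lambda>w. lcross (W w) (cderiv A w) $ j) = P z $ j - P (of_real u0) $ j"
    if "valid_path \<gamma>" "path_image \<gamma> \<subseteq> D" "pathstart \<gamma> = of_real u0" "pathfinish \<gamma> = z" for \<gamma> z j
    using contour_integral_primitive[of D "\<lambda>w. P w $ j", OF has_field_derivative_at_within[OF P] that(1,2)] that(3,4)
    by (auto intro: contour_integral_unique)
  {
    assume "is_bjorling_surface I D u0 \<alpha> V Y"
    then obtain A' W' where A': "holomorphic_extension I D \<alpha> A'"
      and W': "holomorphic_extension I D V W'"
      and Y: "\<And>z \<gamma>. z \<in> D \<Longrightarrow> valid_path \<gamma> \<Longrightarrow> path_image \<gamma> \<subseteq> D \<Longrightarrow>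
          pathstart \<gamma> = of_real u0 \<Longrightarrow> pathfinish \<gamma> = z \<Longrightarrow>
          Y (Re z) (Im z) = (\<chi> j. Re (A' z $ j +
            \<i> * contour_integral \<gamma> (\<lambda>w. lcross (W' w) (cderiv A' w) $ j)))"
      unfolding is_bjorling_surface_def by blast
    \<comment> \<open>The extensions may differ outside \<open>D\<close>; agreement on the open set
      \<open>D\<close> suffices to identify the derivatives and the integrands along paths in
      \<open>D\<close>.\<close>
    have AA': "A' z = A z" and WW': "W' z = W z" if "z \<in> D" for z
      using holomorphic_extension_unique[OF I D(1) conn D(3)] A A' W W' that by blast+
    have dA: "cderiv A' z = cderiv A z" if "z \<in> D" for z
      using cderiv_cong[OF D(1) that] AA' by blast
    show ?R
    proof (intro allI impI)
      fix u v assume z: "Complex u v \<in> D"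
      let ?z = "Complex u v"
      \<comment> \<open>The definition constrains \<open>Y\<close> only through paths, so one must
        be exhibited; a polynomial path in a connected open set is valid.\<close>
      obtain \<gamma> where \<gamma>: "valid_path \<gamma>" "path_image \<gamma> \<subseteq> D" "pathstart \<gamma> = of_real u0" "pathfinish \<gamma> = ?z"
        using connected_open_polynomial_connected[OF D(1) conn, of "of_real u0" ?z] D(3) u0 z
          valid_path_polynomial_function by blast
      have "contour_integral \<gamma> (\<lambda>w. lcross (W' w) (cderiv A' w) $ j) =
            contour_integral \<gamma> (\<lambda>w. lcross (W w) (cderiv A w) $ j)" for j
        using \<gamma>(2) by (intro contour_integral_eq) (auto simp: WW' dA subset_iff)
      then show "Y u v = (\<chi> j. Re (A ?z $ j + \<i> * (P ?z $ j - P (of_real u0) $ j)))"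
        using Y[OF z \<gamma>] ci[OF \<gamma>] by (simp add: AA' z)
    qed
  next
    assume ?R
    then show "is_bjorling_surface I D u0 \<alpha> V Y"
      unfolding is_bjorling_surface_def
      using data u0 D A W by (intro conjI exI[of _ A] exI[of _ W]) (auto simp: ci)
  }
qed

section \<open>The circle\<close>

definition circ_ext :: "complex \<Rightarrow> complex ^ 3" where
  "circ_ext z = vector [cos z, sin z, 0]"

definition circ_V_ext :: "real \<Rightarrow> complex \<Rightarrow> complex ^ 3" where
  "circ_V_ext a z = vector [- sinh (a * z) * cos z, - sinh (a * z) * sin z, cosh (a * z)]"

text \<open>A primitive of V \<times> \<alpha>'. In the first two components, integrating by parts
  twice returns the integrand and produces the denominator. The integration constants are zero, so
  the values on the real axis are real.\<close>

definition circ_primitive :: "real \<Rightarrow> complex \<Rightarrow> complex ^ 3" where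
  "circ_primitive a z = vector
     [- (a * sinh (a * z) * cos z + cosh (a * z) * sin z) / of_real (a\<^sup>2 + 1),
      - (a * sinh (a * z) * sin z - cosh (a * z) * cos z) / of_real (a\<^sup>2 + 1),
      cosh (a * z) / a]"

section \<open>Elementary functions at real and complex arguments\<close>

lemma sinh_of_real: "sinh (of_real x :: complex) = of_real (sinh x)"
  by (simp add: sinh_field_def exp_of_real flip: of_real_minus)

lemma cosh_of_real: "cosh (of_real x :: complex) = of_real (cosh x)"
  by (simp add: cosh_field_def exp_of_real flip: of_real_minus)

lemma sin_Complex: "sin (Complex u v) = Complex (sin u * cosh v) (cos u * sinh v)"
  by (simp add: complex_eq_iff Re_sin Im_sin sinh_field_def cosh_field_def)

lemma cos_Complex: "cos (Complex u v) = Complex (cos u * cosh v) (- sin u * sinh v)"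
  by (simp add: complex_eq_iff Re_cos Im_cos sinh_field_def cosh_field_def field_simps)

lemma sinh_Complex: "sinh (Complex u v) = Complex (sinh u * cos v) (cosh u * sin v)"
  by (simp add: complex_eq_iff sinh_field_def cosh_field_def Re_exp Im_exp field_simps)

lemma cosh_Complex: "cosh (Complex u v) = Complex (cosh u * cos v) (sinh u * sin v)"
  by (simp add: complex_eq_iff sinh_field_def cosh_field_def Re_exp Im_exp field_simps)

lemma of_real_mult_Complex: "of_real a * Complex u v = Complex (a * u) (a * v)"
  by (simp add: complex_eq_iff)

section \<open>Bjorling data on the circle\<close>

lemma holomorphic_extension_circ: "holomorphic_extension I D circ circ_ext"
  by (simp add: holomorphic_extension_def forall_3 circ_def circ_ext_def sin_of_real cos_of_real
      holomorphic_on_sin holomorphic_on_cos)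

lemma holomorphic_extension_circ_V: "holomorphic_extension I D (circ_V a) (circ_V_ext a)"
  unfolding holomorphic_extension_def forall_3 circ_V_eq circ_V_ext_def
  by (auto simp: sin_of_real cos_of_real sinh_of_real cosh_of_real
      intro!: analytic_imp_holomorphic analytic_intros simp flip: of_real_mult)

lemma has_vector_derivative_circ:
  "(circ has_vector_derivative vector [- sin t, cos t, 0]) (at t)"
proof -
  have "((\<lambda>t. circ t $ j) has_real_derivative vector [- sin t, cos t, 0] $ j) (at t)" for j
    using exhaust_3[of j] by (auto simp: circ_def intro!: derivative_eq_intros)
  then show ?thesis
    by (rule has_vector_derivative_componentwise)
qed

text \<open>Analyticity is inherited from the entire extensions; the metric conditions are the
  circular and hyperbolic Pythagorean identities.\<close>

lemma bjorling_data_circ: "bjorling_data UNIV circ (circ_V a)"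
proof -
  have "real_analytic_curve_on UNIV circ" "real_analytic_curve_on UNIV (circ_V a)"
    using real_analytic_curve_on_holomorphic_extension[OF open_UNIV subset_UNIV]
      holomorphic_extension_circ holomorphic_extension_circ_V by blast+
  moreover have "lorentz (circ_V a t) (circ_V a t) = - 1" for t
    using hyperbolic_pythagoras[of "a * t"] sin_cos_squared_add[of t]
    unfolding circ_V_eq lorentz_def vector_3 by algebra
  moreover have "sin t * sin t + cos t * cos t = 1" for t :: real
    by (simp flip: power2_eq_square)
  ultimately show ?thesis
    by (simp add: bjorling_data_def vector_derivative_at[OF has_vector_derivative_circ] 
        is_interval_univ lorentz_def circ_V_eq)
qed

section \<open>The integrand V \<times> \<alpha>' and its primitive\<close>

lemma cderiv_circ_ext: "cderiv circ_ext z = vector [- sin z, cos z, 0]"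
proof (rule cderiv_eqI)
  show "((\<lambda>w. circ_ext w $ j) has_field_derivative vector [- sin z, cos z, 0] $ j) (at z)" for j
    using exhaust_3[of j] by (auto simp: circ_ext_def intro!: derivative_eq_intros)
qed

lemma lcross_circ_ext:
  "lcross (circ_V_ext a z) (cderiv circ_ext z) =
     vector [- cosh (a * z) * cos z, - cosh (a * z) * sin z, sinh (a * z)]"
proof -
  have "sinh (a * z) * sin z * sin z + sinh (a * z) * cos z * cos z = sinh (a * z)"
    using sin_cos_squared_add[of z] by algebra
  then show ?thesis
    by (simp add: vec_eq_iff forall_3 lcross_def cderiv_circ_ext circ_V_ext_def)
qed

lemma has_field_derivative_circ_primitive:
  assumes "a \<noteq> 0"
  shows "((\<lambda>w. circ_primitive a w $ j) has_field_derivative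
           lcross (circ_V_ext a z) (cderiv circ_ext z) $ j) (at z)"
proof -
  let ?c = "complex_of_real (a\<^sup>2 + 1)"
  have c: "?c \<noteq> 0"
    by (simp only: of_real_eq_0_iff) (smt (verit) zero_le_power2)
  \<comment> \<open>The mixed terms \<open>a * sinh (a * z) * sin z\<close> cancel, leaving
    \<open>?c\<close> times the integrand. The second component works the same way.\<close>
  have "((\<lambda>w. - (a * sinh (a * w) * cos w + cosh (a * w) * sin w)) has_field_derivative
          ?c * (- cosh (a * z) * cos z)) (at z)"
    by (auto intro!: derivative_eq_intros simp: algebra_simps power2_eq_square)
  from DERIV_cdivide[OF this, of ?c]
  have 1: "((\<lambda>w. circ_primitive a w $ 1) has_field_derivative - cosh (a * z) * cos z) (at z)"
    using c by (simp only: circ_primitive_def vector_3 nonzero_mult_div_cancel_left not_False_eq_True)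
  have "((\<lambda>w. - (a * sinh (a * w) * sin w - cosh (a * w) * cos w)) has_field_derivative
          ?c * (- cosh (a * z) * sin z)) (at z)"
    by (auto intro!: derivative_eq_intros simp: algebra_simps power2_eq_square)
  from DERIV_cdivide[OF this, of ?c]
  have 2: "((\<lambda>w. circ_primitive a w $ 2) has_field_derivative - cosh (a * z) * sin z) (at z)"
    using c by (simp only: circ_primitive_def vector_3 nonzero_mult_div_cancel_left not_False_eq_True)
  have 3: "((\<lambda>w. circ_primitive a w $ 3) has_field_derivative sinh (a * z)) (at z)"
    unfolding circ_primitive_def vector_3 using assms by (auto intro!: derivative_eq_intros)
  show ?thesis
    using 1 2 3 exhaust_3[of j] by (auto simp: lcross_circ_ext)
qed

section \<open>The isotropic curve and its Bjorling surface\<close>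

definition circ_curve :: "real \<Rightarrow> complex \<Rightarrow> complex ^ 3" where
  "circ_curve a z = circ_ext z + \<i> *s circ_primitive a z"

lemma has_field_derivative_circ_curve:
  assumes "a \<noteq> 0"
  shows "((\<lambda>w. circ_curve a w $ j) has_field_derivative
           (cderiv circ_ext z + \<i> *s lcross (circ_V_ext a z) (cderiv circ_ext z)) $ j) (at z)"
proof -
  have "entire_curve circ_ext"
    using holomorphic_extension_circ[of UNIV UNIV]
    by (simp add: entire_curve_def holomorphic_extension_def)
  then show ?thesis
    using has_field_derivative_circ_primitive[OF assms]
    unfolding circ_curve_def
    by (auto intro!: derivative_eq_intros entire_curve_has_field_derivative)
qed

lemma cderiv_circ_curve:
  assumes "a \<noteq> 0"
  shows "cderiv (circ_curve a) z = vector
     [- sin z - \<i> * cosh (a * z) * cos z, cos z - \<i> * cosh (a * z) * sin z, \<i> * sinh (a * z)]"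
  unfolding cderiv_eqI[OF has_field_derivative_circ_curve[OF assms]] lcross_circ_ext
  by (simp add: cderiv_circ_ext vec_eq_iff forall_3)

lemma entire_curve_circ_curve: "a \<noteq> 0 \<Longrightarrow> entire_curve (circ_curve a)"
  unfolding entire_curve_def holomorphic_on_def field_differentiable_def
  using has_field_derivative_circ_curve has_field_derivative_at_within by blast

text \<open>The derivative is \<alpha>' + i V \<times> \<alpha>'. Since V is unit timelike and
  orthogonal to \<alpha>', the vectors \<alpha>' and V \<times> \<alpha>' are orthogonal with equal
  Lorentzian squares. Here this is verified by direct expansion.\<close>

lemma circ_curve_isotropic:
  assumes "a \<noteq> 0"
  shows "lorentz (cderiv (circ_curve a) z) (cderiv (circ_curve a) z) = 0"
proof -
  have "lorentz (cderiv (circ_curve a) z) (cderiv (circ_curve a) z) =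
        ((sin z)\<^sup>2 + (cos z)\<^sup>2) * (1 - (cosh (a * z))\<^sup>2) + (sinh (a * z))\<^sup>2"
    unfolding cderiv_circ_curve[OF assms] lorentz_def vector_3
    by (simp add: algebra_simps power2_eq_square del: sin_cos_squared_add3)
  then show ?thesis
    by (simp add: cosh_square_eq)
qed

lemma solves_bjorling_problem_circ_curve:
  assumes "a \<noteq> 0"
  shows "solves_bjorling_problem UNIV D circ (circ_V a) (re_surface (circ_curve a))"
proof -
  let ?X = "re_surface (circ_curve a)"
  note entire = entire_curve_circ_curve[OF assms]
  have "?X t 0 = circ t \<and> regular_at ?X t 0 \<and> unit_normal ?X t 0 = circ_V a t" for t
  proof -
    \<comment> \<open>On the real axis X_u = \<alpha>' and X_v = -(V \<times> \<alpha>'). With these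
      signs X_u \<times> X_v is V rather than -V, and no rescaling occurs as <V,V> = -1.\<close>
    have Du: "Du ?X t 0 = vector [- sin t, cos t, 0]"
      and Dv: "Dv ?X t 0 = vector [cosh (a * t) * cos t, cosh (a * t) * sin t, - sinh (a * t)]"
      by (simp_all add: Du_re_surface Dv_re_surface entire re_surface_def cderiv_circ_curve assms
          vec_eq_iff forall_3 of_real_mult_Complex sin_Complex cos_Complex sinh_Complex cosh_Complex)
    have n: "lcross (Du ?X t 0) (Dv ?X t 0) = circ_V a t"
      by (simp add: Du Dv circ_V_eq lcross_def vec_eq_iff forall_3)
        (use sin_cos_squared_add[of t] in algebra)
    have V: "lorentz (circ_V a t) (circ_V a t) = - 1"
      using bjorling_data_circ by (simp add: bjorling_data_def)
    have E: "fff_E ?X t 0 = 1" and F: "fff_F ?X t 0 = 0"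
      using sin_cos_squared_add[of t]
      by (simp_all add: fff_E_def fff_F_def Du Dv lorentz_def flip: power2_eq_square)
    have G: "fff_G ?X t 0 = 1"
      using hyperbolic_pythagoras[of "a * t"] sin_cos_squared_add[of t]
      unfolding fff_G_def Dv lorentz_def vector_3 by algebra
    have "fff_det ?X t 0 = 1"
      by (simp add: fff_det_def E F G)
    \<comment> \<open>What remains after regularity and the normal is the value on the curve:
      \<open>\<i> *s circ_primitive a t\<close> is purely imaginary at real \<open>t\<close>, so
      only \<alpha> survives in the real part.\<close>
    then show ?thesis
      by (simp add: regular_at_def unit_normal_def Let_def n V)
        (simp add: re_surface_def circ_curve_def circ_ext_def circ_primitive_def circ_def
          vec_eq_iff forall_3 of_real_mult_Complex sin_Complex cos_Complex sinh_Complex cosh_Complex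
          Re_divide_of_real Im_divide_of_real flip: of_real_add of_real_power)
  qed
  then show ?thesis
    by (simp add: solves_bjorling_problem_def maximal_surface_on_re_surface entire
        circ_curve_isotropic assms)
qed

lemma is_bjorling_surface_circ_iff:
  assumes "a \<noteq> 0" "open D" "simply_connected D" "range of_real \<subseteq> D"
  shows "is_bjorling_surface UNIV D u0 circ (circ_V a) Y \<longleftrightarrow>
    (\<forall>u v. Complex u v \<in> D \<longrightarrow> Y u v = re_surface (circ_curve a) u v)"
proof -
  \<comment> \<open>Since Re (i P) = - Im P, the constant contributed by \<open>u0\<close> vanishes;
    the surface is the same for every base point.\<close>
  have Im0: "Im (circ_primitive a (of_real u0) $ j) = 0" for j
    using exhaust_3[of j]
    by (auto simp: circ_primitive_def sin_of_real cos_of_real sinh_of_real cosh_of_real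
        simp flip: of_real_mult of_real_add of_real_diff of_real_power of_real_minus of_real_divide)
  show ?thesis
    by (subst is_bjorling_surface_iff[OF bjorling_data_circ UNIV_I assms(2,3,4)
          holomorphic_extension_circ holomorphic_extension_circ_V
          has_field_derivative_circ_primitive[OF assms(1)]])
      (simp add: re_surface_def circ_curve_def Im0)
qed

text \<open>The equivalence carries both existence and uniqueness: \<open>X\<close> is itself a
  Bjorling surface, and every other one agrees with it on \<open>D\<close>.\<close>

theorem mainTheorem1:
  fixes a u0 :: real and D :: "complex set" and X :: "real \<Rightarrow> real \<Rightarrow> real ^ 3"
  assumes a: "a > 0"
    and D: "open D" "simply_connected D" "range complex_of_real \<subseteq> D"
    and X: "\<And>u v. X u v = vector
      [cos u * cosh v + 1 / (a\<^sup>2 + 1) *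
         (a * cos u * sin (a * v) * cosh (a * u) * cosh v
          - a * sin u * cos (a * v) * sinh (a * u) * sinh v
          + cos u * cos (a * v) * cosh (a * u) * sinh v
          + sin u * sin (a * v) * sinh (a * u) * cosh v),
       sin u * cosh v + 1 / (a\<^sup>2 + 1) *
         (a * cos u * cos (a * v) * sinh (a * u) * sinh v
          + a * sin u * sin (a * v) * cosh (a * u) * cosh v
          + sin u * cos (a * v) * cosh (a * u) * sinh v
          - cos u * sin (a * v) * sinh (a * u) * cosh v),
       - (sin (a * v) * sinh (a * u) / a)]"
  shows "(\<forall>Y. is_bjorling_surface UNIV D u0 circ (circ_V a) Y \<longleftrightarrow>
              (\<forall>u v. Complex u v \<in> D \<longrightarrow> Y u v = X u v)) \<and>
         solves_bjorling_problem UNIV D circ (circ_V a) X"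
proof -
  \<comment> \<open>Each coordinate is Re \<open>circ_ext\<close> - Im
    \<open>circ_primitive\<close>; expanding the functions at \<open>Complex u v\<close> into real
    and imaginary parts gives the stated formulas.\<close>
  have "X = re_surface (circ_curve a)"
    by (intro ext)
      (simp add: X re_surface_def circ_curve_def circ_ext_def circ_primitive_def vec_eq_iff
        forall_3 of_real_mult_Complex sin_Complex cos_Complex sinh_Complex cosh_Complex
        Re_divide_of_real Im_divide_of_real algebra_simps add_divide_distrib diff_divide_distrib)
  then show ?thesis
    using a is_bjorling_surface_circ_iff[OF _ D] solves_bjorling_problem_circ_curve by simp
qed

end
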